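(* If $\Omega$ is starlike with respect to $1$, then for every $f \in \mathcal{C}(\Omega)$ and every $r \in (0,1)$, \[ L_r(f) \leq L_r(k_\Omega), \] with equality if and only if $f(z) = \overline{\varepsilon}\, k_\Omega(\varepsilon z)$ for some $\varepsilon \in \partial\mathbb{D}$.
   Context: Let $\mathbb{D} = \{ z \in \mathbb{C} : |z|<1\}$ be the unit disk and $\partial\mathbb{D}$ the unit circle. Let $\mathcal{A}_0$ be the class of analytic functions $f$ in $\mathbb{D}$ with $f(0) = f'(0)-1 = 0$. Let $\Omega$ be a simply connected domain in $\mathbb{C}$ with $1 \in \Omega \neq \mathbb{C}$, and let $\phi_\Omega$ be the unique conformal mapping of $\mathbb{D}$ onto $\Omega$ with $\phi_\Omega(0)=1$ and $\phi_\Omega'(0)>0$. Define \[ \mathcal{C}(\Omega) = \left\{ f \in \mathcal{A}_0 : 1 + \frac{z f''(z)}{f'(z)} \in \Omega \text{ for all } z \in \mathbb{D} \right\}, \] and \[ k_\Omega(z) = \int_0^z \exp\left( \int_0^t \frac{\phi_\Omega(\zeta)-1}{\zeta}\, d\zeta \right) dt, \quad z \in \mathbb{D}, \] so that $k_\Omega \in \mathcal{C}(\Omega)$. For an analytic function $f$ in $\mathbb{D}$ and $0<r<1$, let \[ L_r(f) = \int_{-\pi}^{\pi} r\,|f'(re^{i\theta})|\, d\theta \] denote the arclength of the image of the circle $\{ z : |z| = r\}$ under $f$. *)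

theory Defs
  imports "HOL-Complex_Analysis.Complex_Analysis"
begin

definition starlike_wrt :: "complex set \<Rightarrow> complex \<Rightarrow> bool" where
  "starlike_wrt S a \<longleftrightarrow> a \<in> S \<and> (\<forall>w\<in>S. closed_segment a w \<subseteq> S)"

definition is_riemann_map :: "complex set \<Rightarrow> (complex \<Rightarrow> complex) \<Rightarrow> bool" where
  "is_riemann_map \<Omega> \<phi> \<longleftrightarrow>
     \<phi> holomorphic_on ball 0 1 \<and> inj_on \<phi> (ball 0 1) \<and> \<phi> ` ball 0 1 = \<Omega> \<and>
     \<phi> 0 = 1 \<and> deriv \<phi> 0 \<in> \<real> \<and> Re (deriv \<phi> 0) > 0"

text \<open>The class C(Omega). The condition f'(z) \<noteq> 0 is implicit in the paper
  (the quotient f''/f' must make sense).\<close>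
definition conv_class :: "complex set \<Rightarrow> (complex \<Rightarrow> complex) set" where
  "conv_class \<Omega> = {f. f holomorphic_on ball 0 1 \<and> f 0 = 0 \<and> deriv f 0 = 1 \<and>
      (\<forall>z\<in>ball 0 1. deriv f z \<noteq> 0 \<and>
          1 + z * deriv (deriv f) z / deriv f z \<in> \<Omega>)}"

definition k_fun :: "(complex \<Rightarrow> complex) \<Rightarrow> complex \<Rightarrow> complex" where
  "k_fun \<phi> z = contour_integral (linepath 0 z)
      (\<lambda>t. exp (contour_integral (linepath 0 t) (\<lambda>\<zeta>. (\<phi> \<zeta> - 1) / \<zeta>)))"

definition arclen :: "(complex \<Rightarrow> complex) \<Rightarrow> real \<Rightarrow> real" where
  "arclen f r = integral {-pi..pi} (\<lambda>\<theta>. r * norm (deriv f (of_real r * cis \<theta>)))"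

end

theory Submission
  imports Defs
begin

text \<open>
  Put \<open>g = \<phi> - 1\<close>, \<open>G z = \<integral>\<^sub>0\<^sup>z g \<zeta> / \<zeta> d\<zeta>\<close> and \<open>F = log f'\<close>, so that \<open>k' = exp G\<close>, \<open>z G' = g\<close>, and
  \<open>z F'\<close> takes values in the starlike domain \<open>g ` ball 0 1\<close>.  Starlikeness of \<open>g\<close> makes \<open>G\<close> convex,
  hence univalent: the tangent of \<open>G (r e\<^sup>i\<^sup>t)\<close> turns monotonically by \<open>2\<pi>\<close> in total, so one of the two
  arcs between any two points turns by at most \<open>\<pi>\<close> and cannot close up.  Then \<open>F = G \<circ> v\<close> with
  \<open>\<bar>v z\<bar> \<le> \<bar>z\<bar>\<close> (Suffridge): at a maximum \<open>z\<^sub>0\<close> of \<open>\<bar>v\<bar>\<close> on a disk, Jack's lemma gives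
  \<open>z\<^sub>0 v' = m v\<close> with \<open>m \<ge> 1\<close>, so \<open>g (v z\<^sub>0) = z\<^sub>0 F' z\<^sub>0 / m\<close>, and shrinking a value of \<open>g\<close>
  radially moves its preimage towards the origin.  Finally \<open>\<bar>f'\<bar> = \<bar>K \<circ> v\<bar>\<^sup>2\<close> and \<open>\<bar>k'\<bar> = \<bar>K\<bar>\<^sup>2\<close> for
  \<open>K = exp (G / 2)\<close>, so the claim is Littlewood's subordination principle in \<open>L\<^sup>2\<close>, which follows
  from \<open>\<parallel>c + z A\<parallel>\<^sup>2 = 2\<pi> \<bar>c\<bar>\<^sup>2 + r\<^sup>2 \<parallel>A\<parallel>\<^sup>2\<close> and is strict unless \<open>v\<close> is a rotation.
\<close>

section \<open>Boundary maxima and Jack's lemma\<close>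

text \<open>\<open>V\<close> starts at the boundary point \<open>1\<close> of the closed unit disk
  and stays in that disk, so it cannot set off to the right.\<close>

lemma Re_deriv_nonpos_if_norm_le_start:
  fixes V :: "real \<Rightarrow> complex"
  assumes d: "(V has_vector_derivative D) (at 0)"
    and "V 0 = 1" and le: "\<And>t. t \<ge> 0 \<Longrightarrow> norm (V t) \<le> 1"
  shows "Re D \<le> 0"
proof (rule ccontr)
  assume pos: "\<not> ?thesis"
  have "((\<lambda>t. Re (V t)) has_real_derivative Re D) (at 0)"
    using bounded_linear.has_vector_derivative[OF bounded_linear_Re d]
    by (simp add: has_real_derivative_iff_has_vector_derivative)
  then obtain e where "e > 0" and e: "\<forall>h>0. h < e \<longrightarrow> Re (V 0) < Re (V (0 + h))"
    using DERIV_pos_inc_right[of "\<lambda>t. Re (V t)" "Re D" 0] pos by auto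
  have "Re (V (e/2)) > 1" using e \<open>e > 0\<close> \<open>V 0 = 1\<close> by (auto dest!: spec[of _ "e/2"])
  moreover have "Re (V (e/2)) \<le> 1"
    using le[of "e/2"] complex_Re_le_cmod[of "V (e/2)"] \<open>e > 0\<close> by linarith
  ultimately show False by simp
qed

text \<open>The maximum principle for \<open>v z / z\<close>, extended holomorphically as
  \<open>h\<close>: its modulus on the circle through \<open>z0\<close> is at most that at
  \<open>z0\<close>.\<close>

lemma Schwarz_lemma_max_on_circle:
  assumes hol: "v holomorphic_on ball 0 R" and "v 0 = 0" and z0: "z0 \<in> ball 0 R" "z0 \<noteq> 0"
    and max: "\<And>z. norm z \<le> norm z0 \<Longrightarrow> norm (v z) \<le> norm (v z0)"
    and "norm z \<le> norm z0"
  shows "norm (v z) \<le> norm z * (norm (v z0) / norm z0)"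
proof -
  obtain h where h: "h holomorphic_on ball 0 R" "\<And>z. norm z < R \<Longrightarrow> v z = z * h z"
    using Schwarz3[OF hol \<open>v 0 = 0\<close>] by metis
  have sub: "cball 0 (norm z0) \<subseteq> ball 0 R" using z0 by auto
  have "norm (h z) \<le> norm (v z0) / norm z0"
  proof (rule maximum_modulus_frontier[of h "cball 0 (norm z0)"])
    show "h holomorphic_on interior (cball 0 (norm z0))"
      using h(1) sub interior_subset by (meson holomorphic_on_subset order_trans)
    show "continuous_on (closure (cball 0 (norm z0))) h"
      using h(1) sub by (auto intro: continuous_on_subset holomorphic_on_imp_continuous_on)
    fix w :: complex assume "w \<in> frontier (cball 0 (norm z0))"
    then have w: "norm w = norm z0" by (simp add: frontier_cball sphere_def)
    have "norm w * norm (h w) = norm (v w)" using h(2)[of w] w z0 by (simp add: norm_mult)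
    also have "\<dots> \<le> norm (v z0)" using max w by simp
    finally show "norm (h w) \<le> norm (v z0) / norm z0" using w z0 by (simp add: field_simps)
  qed (use assms in auto)
  then show ?thesis
    using h(2)[of z] assms(6) z0
      mult_left_mono[OF _ norm_ge_zero, of "norm (h z)" "norm (v z0) / norm z0" z]
    by (auto simp: norm_mult)
qed

text \<open>Comparing \<open>v\<close> with its Schwarz bound yields
  \<open>Re (d * (m - 1)) \<le> 0\<close> for every \<open>d\<close> in the closed left half-plane,
  which forces \<open>m - 1\<close> to be real and nonnegative.\<close>

lemma Jack_lemma:
  assumes hol: "v holomorphic_on ball 0 R" and "v 0 = 0" and z0: "z0 \<in> ball 0 R" and nz: "v z0 \<noteq> 0"
    and max: "\<And>z. norm z \<le> norm z0 \<Longrightarrow> norm (v z) \<le> norm (v z0)"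
  obtains m :: real where "m \<ge> 1" "z0 * deriv v z0 = of_real m * v z0"
proof -
  have z0nz: "z0 \<noteq> 0" using nz \<open>v 0 = 0\<close> by auto
  define m where "m = z0 * deriv v z0 / v z0"
  have dv: "(v has_field_derivative deriv v z0) (at z0)"
    using hol z0 by (auto intro: holomorphic_derivI[OF _ open_ball])
  \<comment> \<open>Move off \<open>z0\<close> along the spirals \<open>z0 * exp (t * d)\<close>, which stay in the disk.\<close>
  have key: "Re (d * m - d) \<le> 0" if "Re d \<le> 0" for d
  proof (rule Re_deriv_nonpos_if_norm_le_start)
    \<comment> \<open>The factor \<open>exp (- of_real t * d)\<close> cancels the growth
      \<open>exp (t * Re d)\<close> that the Schwarz bound permits; dividing by \<open>v z0\<close>
      makes the curve start at \<open>1\<close>.\<close>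
    define V where "V t = v (z0 * exp (of_real t * d)) * exp (- of_real t * d) / v z0" for t :: real
    have "((\<lambda>t. v (z0 * exp (t * d)) * exp (- t * d) / v z0) has_field_derivative d * m - d) (at (of_real 0))"
    proof -
      have 1: "((\<lambda>t. z0 * exp (t * d)) has_field_derivative z0 * d) (at 0)"
        by (auto intro!: derivative_eq_intros)
      have 2: "((\<lambda>t. v (z0 * exp (t * d))) has_field_derivative deriv v z0 * (z0 * d)) (at 0)"
        by (rule DERIV_chain2[OF _ 1]) (simp add: dv)
      have 3: "((\<lambda>t. exp (- t * d)) has_field_derivative - d) (at 0)"
        by (auto intro!: derivative_eq_intros)
      show ?thesis
        using DERIV_cdivide[OF DERIV_mult[OF 2 3], of "v z0"] nz by (simp add: m_def field_simps)
    qed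
    from has_vector_derivative_real_field[OF this]
    show "(V has_vector_derivative d * m - d) (at 0)"
      by (simp add: V_def[abs_def])
    show "V 0 = 1" using nz by (simp add: V_def)
    fix t :: real assume "t \<ge> 0"
    have "norm (z0 * exp (of_real t * d)) \<le> norm z0"
      using \<open>t \<ge> 0\<close> that by (simp add: norm_mult mult_left_le mult_nonneg_nonpos)
    from Schwarz_lemma_max_on_circle[OF hol \<open>v 0 = 0\<close> z0 z0nz max this]
    have "norm (v (z0 * exp (of_real t * d))) \<le> exp (t * Re d) * norm (v z0)"
      using z0nz by (simp add: norm_mult)
    then show "norm (V t) \<le> 1"
      using nz by (simp add: V_def norm_mult norm_divide exp_minus field_simps)
  qed
  have "Im m = 0" using key[of \<i>] key[of "-\<i>"] by simp
  moreover have "Re m \<ge> 1" using key[of "-1"] by simp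
  ultimately have "m = of_real (Re m)" "Re m \<ge> 1" by (simp_all add: complex_eq_iff)
  then show ?thesis
    using that[of "Re m"] nz by (metis m_def nonzero_divide_eq_eq)
qed

section \<open>Primitives on disks and derivatives along circles\<close>

lemma holomorphic_primitive_ball:
  assumes "q holomorphic_on ball 0 R" and "R > 0"
  obtains Q where "Q 0 = 0" "\<And>z. z \<in> ball 0 R \<Longrightarrow> (Q has_field_derivative q z) (at z)"
proof -
  obtain Q where Q: "\<And>z. z \<in> ball 0 R \<Longrightarrow> (Q has_field_derivative q z) (at z within ball 0 R)"
    using holomorphic_convex_primitive'[OF convex_ball open_ball assms(1)] by metis
  show ?thesis
  proof (rule that[of "\<lambda>z. Q z - Q 0"])
    fix z :: complex assume "z \<in> ball 0 R"
    then have "(Q has_field_derivative q z) (at z)"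
      using Q by (metis at_within_open open_ball)
    then show "((\<lambda>z. Q z - Q 0) has_field_derivative q z) (at z)"
      by (auto intro!: derivative_eq_intros)
  qed auto
qed

lemma has_vector_derivative_along_circle:
  assumes "(h has_field_derivative D) (at (of_real r * cis t))"
  shows "((\<lambda>t. h (of_real r * cis t)) has_vector_derivative D * (\<i> * (of_real r * cis t))) (at t)"
proof -
  have c: "((\<lambda>s. of_real r * exp (\<i> * s)) has_field_derivative \<i> * (of_real r * cis t)) (at (of_real t))"
    by (auto intro!: derivative_eq_intros simp: cis_conv_exp)
  have "((\<lambda>s. h (of_real r * exp (\<i> * s))) has_field_derivative D * (\<i> * (of_real r * cis t))) (at (of_real t))"
    by (rule DERIV_chain2[OF _ c]) (use assms in \<open>simp add: cis_conv_exp\<close>)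
  from has_vector_derivative_real_field[OF this] show ?thesis
    by (simp flip: cis_conv_exp)
qed

section \<open>Littlewood's inequality\<close>

lemma norm_cis_mult [simp]: "norm (complex_of_real r * cis t) = \<bar>r\<bar>"
  by (simp add: norm_mult)

lemma continuous_on_circle:
  assumes "h holomorphic_on ball 0 1" "0 \<le> r" "r < 1"
  shows "continuous_on S (\<lambda>t. h (of_real r * cis t))"
  by (rule continuous_on_compose2[OF holomorphic_on_imp_continuous_on[OF assms(1)]])
     (use assms in \<open>auto intro!: continuous_intros\<close>)

text \<open>With \<open>Q\<close> a primitive of \<open>h z / z\<close>, the integrand is the
  derivative of \<open>Q (of_real r * cis t) / \<i>\<close>, which agrees at \<open>-pi\<close> and
  \<open>pi\<close>.\<close>

lemma circle_mean_zero:
  assumes hol: "h holomorphic_on ball 0 1" and "h 0 = 0" and r: "0 < r" "r < 1"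
  shows "((\<lambda>t. h (of_real r * cis t)) has_integral 0) {-pi..pi}"
proof -
  obtain q where q: "q holomorphic_on ball 0 1" "\<And>z. norm z < 1 \<Longrightarrow> h z = z * q z"
    using Schwarz3[OF hol \<open>h 0 = 0\<close>] by metis
  obtain Q where Q: "\<And>z. z \<in> ball 0 1 \<Longrightarrow> (Q has_field_derivative q z) (at z)"
    using holomorphic_primitive_ball[OF q(1)] by (metis zero_less_one)
  have "((\<lambda>t. Q (of_real r * cis t) / \<i>) has_vector_derivative h (of_real r * cis t)) (at t)" for t
  proof -
    have z: "norm (of_real r * cis t) < 1" using r by simp
    then have "((\<lambda>z. Q z / \<i>) has_field_derivative q (of_real r * cis t) / \<i>) (at (of_real r * cis t))"
      by (intro DERIV_cdivide Q) simp
    from has_vector_derivative_along_circle[OF this] show ?thesis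
      using q(2)[OF z] by (simp add: field_simps)
  qed
  then have "((\<lambda>t. h (of_real r * cis t)) has_integral
      Q (of_real r * cis pi) / \<i> - Q (of_real r * cis (-pi)) / \<i>) {-pi..pi}"
    by (intro fundamental_theorem_of_calculus)
       (auto intro: has_vector_derivative_at_within)
  moreover have "cis (-pi) = cis pi" by (simp add: complex_eq_iff)
  ultimately show ?thesis by simp
qed

text \<open>The squared L^2 norm in the angle, without the factor
  \<open>1 / (2 * pi)\<close>.\<close>

definition circle_energy :: "(complex \<Rightarrow> complex) \<Rightarrow> real \<Rightarrow> real" where
  "circle_energy h r = integral {-pi..pi} (\<lambda>t. (norm (h (of_real r * cis t)))\<^sup>2)"

lemma circle_energy_integrable:
  assumes "h holomorphic_on ball 0 1" "0 \<le> r" "r < 1"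
  shows "(\<lambda>t. (norm (h (of_real r * cis t)))\<^sup>2) integrable_on {-pi..pi}"
  by (intro integrable_continuous_real continuous_intros continuous_on_circle assms)

text \<open>Orthogonality: the cross term \<open>2 * Re (cnj c * h z)\<close> integrates to zero
  because \<open>h\<close> vanishes at the origin.\<close>

lemma circle_energy_add_const:
  assumes hol: "h holomorphic_on ball 0 1" and "h 0 = 0" and r: "0 < r" "r < 1"
  shows "circle_energy (\<lambda>z. c + h z) r = 2 * pi * (norm c)\<^sup>2 + circle_energy h r"
proof -
  let ?h = "\<lambda>t. h (of_real r * cis t)"
  have "((\<lambda>t. 2 * Re (cnj c * ?h t)) has_integral 2 * Re (cnj c * 0)) {-pi..pi}"
    by (intro has_integral_mult_right has_integral_Re circle_mean_zero assms)
  moreover have "((\<lambda>t. (norm (?h t))\<^sup>2) has_integral circle_energy h r) {-pi..pi}"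
    unfolding circle_energy_def
    using circle_energy_integrable[OF hol] r by (simp add: integrable_integral)
  moreover have "((\<lambda>t. (norm c)\<^sup>2) has_integral 2 * pi * (norm c)\<^sup>2) {-pi..pi}"
    using has_integral_const_real[of "(norm c)\<^sup>2" "-pi" pi] by simp
  ultimately have "((\<lambda>t. (norm c)\<^sup>2 + (norm (?h t))\<^sup>2 + 2 * Re (cnj c * ?h t)) has_integral
      2 * pi * (norm c)\<^sup>2 + circle_energy h r + 2 * Re (cnj c * 0)) {-pi..pi}"
    by (intro has_integral_add)
  moreover have "(norm c)\<^sup>2 + (norm (?h t))\<^sup>2 + 2 * Re (cnj c * ?h t) = (norm (c + ?h t))\<^sup>2" for t
    by (simp only: cmod_power2) (simp add: power2_eq_square algebra_simps)
  ultimately show ?thesis unfolding circle_energy_def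
    by (intro integral_unique) simp
qed

lemma circle_energy_mult_le:
  assumes hol: "v holomorphic_on ball 0 1" "K holomorphic_on ball 0 1" and r: "0 < r" "r < 1"
    and le: "\<And>z. norm z < 1 \<Longrightarrow> norm (v z) \<le> norm z"
  shows "circle_energy (\<lambda>z. v z * K z) r \<le> r\<^sup>2 * circle_energy K r"
  unfolding circle_energy_def integral_mult_right[symmetric]
proof (rule integral_le)
  show "(\<lambda>t. (norm (v (of_real r * cis t) * K (of_real r * cis t)))\<^sup>2) integrable_on {-pi..pi}"
    using r by (intro circle_energy_integrable[of "\<lambda>z. v z * K z"]) (auto intro!: holomorphic_intros hol)
  show "(\<lambda>t. r\<^sup>2 * (norm (K (of_real r * cis t)))\<^sup>2) integrable_on {-pi..pi}"
    using r by (intro integrable_on_mult_right circle_energy_integrable hol) auto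
  fix t
  show "(norm (v (of_real r * cis t) * K (of_real r * cis t)))\<^sup>2 \<le> r\<^sup>2 * (norm (K (of_real r * cis t)))\<^sup>2"
    using le[of "of_real r * cis t"] r by (auto simp: norm_mult power_mult_distrib intro!: mult_right_mono power_mono)
qed

lemma circle_energy_mult_id:
  assumes "0 < r"
  shows "circle_energy (\<lambda>z. z * K z) r = r\<^sup>2 * circle_energy K r"
  unfolding circle_energy_def integral_mult_right[symmetric]
  using assms by (simp add: norm_mult power_mult_distrib)

text \<open>Induction on the number of coefficients, peeling off \<open>a 0\<close>: it contributes
  equally on both sides, and the factor in front of the rest costs at most \<open>r\<^sup>2\<close>
  as \<open>v z\<close> but exactly \<open>r\<^sup>2\<close> as \<open>z\<close>. The coefficients
  are generalised because those of the rest \<open>A\<close> are shifted.\<close>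

lemma Littlewood_polynomial:
  assumes hol: "v holomorphic_on ball 0 1" and r: "0 < r" "r < 1"
    and le: "\<And>z. norm z < 1 \<Longrightarrow> norm (v z) \<le> norm z"
  shows "circle_energy (\<lambda>z. \<Sum>j<n. a j * v z ^ j) r \<le> circle_energy (\<lambda>z. \<Sum>j<n. a j * z ^ j) r"
proof (induction n arbitrary: a)
  case (Suc n)
  define A where "A w = (\<Sum>j<n. a (Suc j) * w ^ j)" for w
  have eq: "(\<Sum>j<Suc n. a j * w ^ j) = a 0 + w * A w" for w
    by (simp only: sum.lessThan_Suc_shift A_def) (simp add: sum_distrib_left mult_ac)
  have "v 0 = 0" using le[of 0] by simp
  have holA: "A holomorphic_on ball 0 1" "(\<lambda>z. A (v z)) holomorphic_on ball 0 1"
    unfolding A_def by (intro holomorphic_intros hol)+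
  have "circle_energy (\<lambda>z. v z * A (v z)) r \<le> r\<^sup>2 * circle_energy (\<lambda>z. A (v z)) r"
    by (intro circle_energy_mult_le assms holA)
  also have "\<dots> \<le> r\<^sup>2 * circle_energy A r"
    using Suc.IH[of "\<lambda>j. a (Suc j)"] unfolding A_def by (intro mult_left_mono) auto
  also have "\<dots> = circle_energy (\<lambda>z. z * A z) r"
    using r by (simp add: circle_energy_mult_id)
  finally have "circle_energy (\<lambda>z. v z * A (v z)) r \<le> circle_energy (\<lambda>z. z * A z) r" .
  moreover have "circle_energy (\<lambda>z. a 0 + v z * A (v z)) r =
      2 * pi * (norm (a 0))\<^sup>2 + circle_energy (\<lambda>z. v z * A (v z)) r"
    using \<open>v 0 = 0\<close> r by (intro circle_energy_add_const holomorphic_intros hol holA) auto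
  moreover have "circle_energy (\<lambda>z. a 0 + z * A z) r =
      2 * pi * (norm (a 0))\<^sup>2 + circle_energy (\<lambda>z. z * A z) r"
    using r by (intro circle_energy_add_const holomorphic_intros holA) auto
  ultimately show ?case unfolding eq by simp
qed simp

lemma uniform_limit_Taylor:
  assumes hol: "K holomorphic_on ball 0 1" and r: "0 < r" "r < 1"
  obtains a where "uniform_limit (cball 0 r) (\<lambda>n z. \<Sum>j<n. a j * z ^ j) K sequentially"
proof -
  define a where "a n = (deriv ^^ n) K 0 / fact n" for n
  have sums: "(\<lambda>n. a n * z ^ n) sums K z" if "norm z < 1" for z
    using holomorphic_power_series[OF hol, of z] that by (simp add: a_def)
  \<comment> \<open>A radius strictly between \<open>r\<close> and \<open>1\<close> makes the radius
    of convergence exceed \<open>r\<close>, hence convergence uniform on the closed disk.\<close>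
  have "summable (\<lambda>n. a n * complex_of_real ((1 + r) / 2) ^ n)"
    using r by (intro sums_summable[OF sums]) (auto simp del: of_real_divide of_real_add)
  from conv_radius_geI[OF this] have "ereal ((1 + r) / 2) \<le> conv_radius a"
    using r by (simp del: of_real_divide of_real_add)
  moreover have "ereal r < ereal ((1 + r) / 2)" using r by simp
  ultimately have "ereal r < conv_radius a" by (rule less_le_trans[rotated])
  from powser_uniform_limit[OF this, of 0]
  have "uniform_limit (cball 0 r) (\<lambda>n z. \<Sum>j<n. a j * z ^ j) (\<lambda>z. suminf (\<lambda>n. a n * z ^ n)) sequentially"
    by simp
  then have "uniform_limit (cball 0 r) (\<lambda>n z. \<Sum>j<n. a j * z ^ j) K sequentially"
    by (rule uniform_limit_cong'[THEN iffD1, rotated -1])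
       (use r sums in \<open>auto simp: sums_iff\<close>)
  then show ?thesis using that by blast
qed

text \<open>On the circle \<open>v\<close> takes values in \<open>cball 0 r\<close>, so uniform
  convergence carries over to the composites; boundedness of the limit lets it pass to squares. The
  choice \<open>v z = z\<close> covers the energies without composition.\<close>

lemma circle_energy_tendsto:
  assumes lim: "uniform_limit (cball 0 r) P K sequentially"
    and hol: "K holomorphic_on ball 0 1" "\<And>n. P n holomorphic_on ball 0 1" "v holomorphic_on ball 0 1"
    and r: "0 < r" "r < 1"
    and le: "\<And>z. norm z < 1 \<Longrightarrow> norm (v z) \<le> norm z"
  shows "(\<lambda>n. circle_energy (\<lambda>z. P n (v z)) r) \<longlonglongrightarrow> circle_energy (\<lambda>z. K (v z)) r"
proof -
  let ?c = "\<lambda>t. v (of_real r * cis t)"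
  have v: "?c t \<in> cball 0 r" for t using le[of "of_real r * cis t"] r by auto
  have vb: "v ` ball 0 1 \<subseteq> ball 0 1" using le by force
  have lim': "uniform_limit {-pi..pi} (\<lambda>n t. norm (P n (?c t))) (\<lambda>t. norm (K (?c t))) sequentially"
    using lim v by (intro uniform_limit_intros) (auto intro: uniform_limit_compose')
  have Kv: "(\<lambda>z. K (v z)) holomorphic_on ball 0 1"
    using holomorphic_on_compose_gen[OF hol(3,1) vb] by (simp add: o_def)
  have Pv: "(\<lambda>z. P n (v z)) holomorphic_on ball 0 1" for n
    using holomorphic_on_compose_gen[OF hol(3,2) vb] by (simp add: o_def)
  have "bounded ((\<lambda>t. norm (K (?c t))) ` {-pi..pi})"
    using r by (intro compact_imp_bounded compact_continuous_image continuous_intros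
      continuous_on_circle[OF Kv]) auto
  then have ul: "uniform_limit {-pi..pi} (\<lambda>n t. (norm (P n (?c t)))\<^sup>2) (\<lambda>t. (norm (K (?c t)))\<^sup>2) sequentially"
    unfolding power2_eq_square by (intro uniform_lim_mult lim')
  show ?thesis unfolding circle_energy_def
  proof (rule uniform_limit_integral[OF ul, THEN exE])
    show "continuous_on {-pi..pi} (\<lambda>t. (norm (P n (?c t)))\<^sup>2)" for n
      using r by (intro continuous_intros continuous_on_circle[OF Pv]) auto
  qed (auto simp: has_integral_iff)
qed

lemma Littlewood_inequality:
  assumes hol: "v holomorphic_on ball 0 1" "K holomorphic_on ball 0 1" and r: "0 < r" "r < 1"
    and le: "\<And>z. norm z < 1 \<Longrightarrow> norm (v z) \<le> norm z"
  shows "circle_energy (\<lambda>z. K (v z)) r \<le> circle_energy K r"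
proof -
  obtain a where a: "uniform_limit (cball 0 r) (\<lambda>n z. \<Sum>j<n. a j * z ^ j) K sequentially"
    using uniform_limit_Taylor[OF hol(2) r] .
  show ?thesis
  proof (rule LIMSEQ_le)
    show "(\<lambda>n. circle_energy (\<lambda>z. \<Sum>j<n. a j * v z ^ j) r) \<longlonglongrightarrow> circle_energy (\<lambda>z. K (v z)) r"
      by (rule circle_energy_tendsto[OF a]) (auto intro!: holomorphic_intros assms)
    show "(\<lambda>n. circle_energy (\<lambda>z. \<Sum>j<n. a j * z ^ j) r) \<longlonglongrightarrow> circle_energy K r"
      by (rule circle_energy_tendsto[OF a]) (auto intro!: holomorphic_intros assms)
  qed (use Littlewood_polynomial[OF hol(1) r le] in blast)
qed

text \<open>With \<open>K z = K 0 + z * A z\<close>, equality forces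
  \<open>norm (v z) = norm z\<close> wherever \<open>A (v z)\<close> is nonzero on the circle. As
  \<open>A 0 = deriv K 0\<close> is nonzero, such a point exists, and the equality case of the
  Schwarz lemma makes \<open>v\<close> a rotation.\<close>

lemma Littlewood_equality:
  assumes hol: "v holomorphic_on ball 0 1" "K holomorphic_on ball 0 1" and r: "0 < r" "r < 1"
    and le: "\<And>z. norm z < 1 \<Longrightarrow> norm (v z) \<le> norm z"
    and K': "deriv K 0 \<noteq> 0"
    and eq: "circle_energy (\<lambda>z. K (v z)) r = circle_energy K r"
  obtains \<epsilon> where "norm \<epsilon> = 1" "\<And>z. norm z < 1 \<Longrightarrow> v z = \<epsilon> * z"
proof -
  have "v 0 = 0" using le[of 0] by simp
  have vb: "v ` ball 0 1 \<subseteq> ball 0 1" using le by force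
  have "(\<lambda>z. K z - K 0) holomorphic_on ball 0 1"
    by (intro holomorphic_intros hol)
  then obtain A where A: "A holomorphic_on ball 0 1" "\<And>z. norm z < 1 \<Longrightarrow> K z - K 0 = z * A z"
      "deriv (\<lambda>z. K z - K 0) 0 = A 0"
    using Schwarz3[of "\<lambda>z. K z - K 0" 1] by auto
  have "deriv (\<lambda>z. K z - K 0) 0 = deriv K 0"
    using holomorphic_on_imp_differentiable_at[OF hol(2) open_ball, of 0] by simp
  then have "A 0 \<noteq> 0" using A(3) K' by simp
  have holAv: "(\<lambda>z. A (v z)) holomorphic_on ball 0 1"
    using holomorphic_on_compose_gen[OF hol(1) A(1) vb] by (simp add: o_def)
  have "circle_energy (\<lambda>z. K (v z)) r = circle_energy (\<lambda>z. K 0 + v z * A (v z)) r"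
    "circle_energy K r = circle_energy (\<lambda>z. K 0 + z * A z) r"
  proof -
    have *: "K z = K 0 + z * A z" if "norm z < 1" for z
      using A(2)[OF that] by (simp add: algebra_simps)
    have **: "norm (v (of_real r * cis t)) < 1" for t
      using le[of "of_real r * cis t"] r by auto
    show "circle_energy (\<lambda>z. K (v z)) r = circle_energy (\<lambda>z. K 0 + v z * A (v z)) r"
      unfolding circle_energy_def by (subst *[OF **]) simp
    have ***: "norm (of_real r * cis t) < 1" for t using r by simp
    show "circle_energy K r = circle_energy (\<lambda>z. K 0 + z * A z) r"
      unfolding circle_energy_def by (subst *[OF ***]) simp
  qed
  moreover have "circle_energy (\<lambda>z. K 0 + v z * A (v z)) r =
      2 * pi * (norm (K 0))\<^sup>2 + circle_energy (\<lambda>z. v z * A (v z)) r"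
    using \<open>v 0 = 0\<close> r by (intro circle_energy_add_const holomorphic_intros hol holAv) auto
  moreover have "circle_energy (\<lambda>z. K 0 + z * A z) r =
      2 * pi * (norm (K 0))\<^sup>2 + r\<^sup>2 * circle_energy A r"
    unfolding circle_energy_mult_id[OF r(1), symmetric]
    using r by (intro circle_energy_add_const holomorphic_intros A) auto
  ultimately have "circle_energy (\<lambda>z. v z * A (v z)) r = r\<^sup>2 * circle_energy A r"
    using eq by simp
  moreover have "r\<^sup>2 * circle_energy (\<lambda>z. A (v z)) r \<le> r\<^sup>2 * circle_energy A r"
    by (intro mult_left_mono Littlewood_inequality assms A) auto
  ultimately have ge: "r\<^sup>2 * circle_energy (\<lambda>z. A (v z)) r \<le> circle_energy (\<lambda>z. v z * A (v z)) r"
    by simp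
  \<comment> \<open>The pointwise loss in replacing \<open>norm (v z)\<close> by \<open>r\<close>:
    nonnegative and continuous, with integral at most zero by \<open>ge\<close>.\<close>
  let ?D = "\<lambda>t. (r\<^sup>2 - (norm (v (of_real r * cis t)))\<^sup>2) * (norm (A (v (of_real r * cis t))))\<^sup>2"
  have "integral {-pi..pi} ?D = r\<^sup>2 * circle_energy (\<lambda>z. A (v z)) r - circle_energy (\<lambda>z. v z * A (v z)) r"
  proof -
    have "(\<lambda>t. (norm (v (of_real r * cis t) * A (v (of_real r * cis t))))\<^sup>2) integrable_on {-pi..pi}"
      using r by (intro circle_energy_integrable[of "\<lambda>z. v z * A (v z)"]) (auto intro!: holomorphic_intros hol holAv)
    moreover have "(\<lambda>t. r\<^sup>2 * (norm (A (v (of_real r * cis t))))\<^sup>2) integrable_on {-pi..pi}"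
      using r by (intro integrable_on_mult_right circle_energy_integrable holAv) auto
    ultimately show ?thesis
      unfolding circle_energy_def integral_mult_right[symmetric]
      by (subst Henstock_Kurzweil_Integration.integral_diff[symmetric])
         (auto simp: norm_mult power_mult_distrib algebra_simps)
  qed
  have nonneg: "?D t \<ge> 0" for t
    using le[of "of_real r * cis t"] r by (auto intro!: mult_nonneg_nonneg power_mono)
  have cont: "continuous_on {-pi..pi} ?D"
    using r by (intro continuous_intros continuous_on_circle[OF hol(1)] continuous_on_circle[OF holAv]) auto
  have "integral {-pi..pi} ?D \<ge> 0" using nonneg cont
    by (intro Henstock_Kurzweil_Integration.integral_nonneg integrable_continuous_real) auto
  with ge \<open>integral {-pi..pi} ?D = _\<close> have "integral {-pi..pi} ?D = 0" by linarith
  then have D0: "?D t = 0" if "t \<in> {-pi..pi}" for t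
    using integral_eq_0_iff[OF cont] nonneg that by simp
  \<comment> \<open>Otherwise the maximum principle would make \<open>A (v z)\<close> vanish at the
    origin as well, where its value is \<open>A 0\<close>.\<close>
  have "\<exists>t\<in>{-pi..pi}. A (v (of_real r * cis t)) \<noteq> 0"
  proof (rule ccontr)
    assume neg: "\<not> ?thesis"
    have "norm (A (v 0)) \<le> 0"
    proof (rule maximum_modulus_frontier[of "\<lambda>z. A (v z)" "cball 0 r"])
      show "(\<lambda>z. A (v z)) holomorphic_on interior (cball 0 r)"
        by (rule holomorphic_on_subset[OF holAv]) (use r in auto)
      show "continuous_on (closure (cball 0 r)) (\<lambda>z. A (v z))"
        by (rule continuous_on_subset[OF holomorphic_on_imp_continuous_on[OF holAv]]) (use r in auto)
      fix z :: complex assume "z \<in> frontier (cball 0 r)"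
      then have "norm z = r" by (simp add: sphere_def)
      then have "z = of_real r * cis (Arg z)" using rcis_cmod_Arg[of z] by (simp add: rcis_def)
      moreover have "Arg z \<in> {-pi..pi}" using Arg_bounded[of z] by auto
      ultimately show "norm (A (v z)) \<le> 0" using neg by (metis norm_le_zero_iff)
    qed (use r in auto)
    then show False using \<open>v 0 = 0\<close> \<open>A 0 \<noteq> 0\<close> by simp
  qed
  then obtain t where t: "t \<in> {-pi..pi}" "A (v (of_real r * cis t)) \<noteq> 0" by blast
  with D0[of t] have "(norm (v (of_real r * cis t)))\<^sup>2 = r\<^sup>2" by simp
  then have "norm (v (of_real r * cis t)) = norm (of_real r * cis t)"
    using r by simp
  then have "\<exists>z. norm z < 1 \<and> z \<noteq> 0 \<and> norm (v z) = norm z"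
    using r by (intro exI[of _ "of_real r * cis t"]) auto
  then have "\<exists>\<epsilon>. (\<forall>z. norm z < 1 \<longrightarrow> v z = \<epsilon> * z) \<and> norm \<epsilon> = 1"
    by (intro Schwarz_Lemma(3)[OF hol(1) \<open>v 0 = 0\<close>, of 0] disjI1) (auto intro: le_less_trans[OF le])
  then show ?thesis using that by blast
qed

section \<open>Univalence of convex functions\<close>

text \<open>As \<open>deriv G z = exp (L z)\<close>, the hypothesis \<open>pos\<close> is the
  classical convexity condition on \<open>G\<close>: the tangent to the image of each circle turns
  strictly counterclockwise, by \<open>2 * pi\<close> in total.\<close>

lemma convex_univalent_on_circle:
  assumes holL: "L holomorphic_on ball 0 1"
    and dG: "\<And>z. z \<in> ball 0 1 \<Longrightarrow> (G has_field_derivative exp (L z)) (at z)"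
    and pos: "\<And>z. z \<in> ball 0 1 \<Longrightarrow> Re (1 + z * deriv L z) > 0"
    and "norm x < 1" "norm x = norm y" "G x = G y"
  shows "x = y"
proof (rule ccontr)
  assume "x \<noteq> y"
  define r where "r = norm x"
  have r: "0 < r" "r < 1" using assms(4,5) \<open>x \<noteq> y\<close> by (auto simp: r_def)
  define c where "c t = complex_of_real r * cis t" for t
  have c: "c t \<in> ball 0 1" for t using r by (simp add: c_def norm_mult)
  have c_per: "c (t + 2 * pi) = c t" for t by (simp add: c_def complex_eq_iff)
  define T where "T t = t + Im (L (c t))" for t
  have dT: "(T has_real_derivative Re (1 + c t * deriv L (c t))) (at t)" for t
  proof -
    have "(L has_field_derivative deriv L (c t)) (at (c t))"
      using holomorphic_derivI[OF holL open_ball c] .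
    from has_vector_derivative_along_circle[OF this[unfolded c_def]]
    have "((\<lambda>t. Im (L (c t))) has_vector_derivative Im (deriv L (c t) * (\<i> * c t))) (at t)"
      unfolding c_def by (rule bounded_linear.has_vector_derivative[OF bounded_linear_Im])
    then have "((\<lambda>t. Im (L (c t))) has_real_derivative Re (c t * deriv L (c t))) (at t)"
      by (simp add: has_real_derivative_iff_has_vector_derivative algebra_simps)
    from DERIV_add[OF DERIV_ident this] show ?thesis unfolding T_def by simp
  qed
  have T_mono: "T a < T b" if "a < b" for a b
    using DERIV_pos_imp_increasing[OF that, of T] dT pos[OF c] by blast
  \<comment> \<open>\<open>T t + pi / 2\<close> is the direction of the tangent; an arc along which it turns by at most \<open>pi\<close>
    advances in a fixed direction, so it cannot close up.\<close>
  have arc: "G (c a) \<noteq> G (c b)" if "a < b" "T b - T a \<le> pi" for a b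
  proof -
    \<comment> \<open>The component of \<open>G (c t)\<close> normal to the curve at parameter
      \<open>a\<close>. Its derivative has the sign of \<open>sin (T t - T a)\<close>, positive
      inside the arc, whereas \<open>G (c a) = G (c b)\<close> would give
      \<open>s a = s b\<close>.\<close>
    define s where "s t = Im (G (c t) * (cis (- T a) / \<i>))" for t
    have ds: "(s has_real_derivative r * exp (Re (L (c t))) * sin (T t - T a)) (at t)" for t
    proof -
      from has_vector_derivative_along_circle[OF dG[OF c, unfolded c_def]]
      have "((\<lambda>t. G (c t)) has_vector_derivative exp (L (c t)) * (\<i> * c t)) (at t)"
        unfolding c_def .
      from bounded_linear.has_vector_derivative[OF bounded_linear_Im
          bounded_linear.has_vector_derivative[OF bounded_linear_mult_left this]]
      have "(s has_vector_derivative Im (exp (L (c t)) * (\<i> * c t) * (cis (- T a) / \<i>))) (at t)"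
        unfolding s_def .
      moreover have "exp (L (c t)) * (\<i> * c t) * (cis (- T a) / \<i>) = exp (L (c t)) * c t * cis (- T a)"
        by (simp add: field_simps)
      moreover have "exp (L (c t)) * c t * cis (- T a) = of_real (r * exp (Re (L (c t)))) * cis (T t - T a)"
      proof -
        have "cis (T t - T a) = cis (Im (L (c t))) * cis t * cis (- T a)"
          by (simp add: T_def cis_mult algebra_simps)
        then show ?thesis by (simp add: exp_eq_polar c_def)
      qed
      ultimately have "(s has_vector_derivative Im (of_real (r * exp (Re (L (c t)))) * cis (T t - T a))) (at t)"
        by metis
      then show ?thesis
        by (simp add: has_real_derivative_iff_has_vector_derivative)
    qed
    have "s a < s b"
    proof (rule DERIV_pos_imp_increasing_open[OF that(1)])
      fix t assume t: "a < t" "t < b"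
      have "0 < T t - T a" "T t - T a < pi" using T_mono[OF t(1)] T_mono[OF t(2)] that(2) by auto
      then have "sin (T t - T a) > 0" by (rule sin_gt_zero)
      then show "\<exists>y. (s has_real_derivative y) (at t) \<and> y > 0" using ds[of t] r by force
    next
      show "continuous_on {a..b} s"
        using ds by (meson DERIV_isCont continuous_at_imp_continuous_on)
    qed
    then show ?thesis by (auto simp: s_def)
  qed
  have ex: "\<exists>t. z = c t \<and> -pi < t \<and> t \<le> pi" if "norm z = r" for z
    using that rcis_cmod_Arg[of z] Arg_bounded[of z] unfolding c_def rcis_def by metis
  have no: "G (c a) \<noteq> G (c b)" if "a < b" "b < a + 2 * pi" for a b
  proof (cases "T b - T a \<le> pi")
    case True then show ?thesis using arc that by blast
  next
    case False
    \<comment> \<open>If the arc from \<open>a\<close> to \<open>b\<close> turns by more than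
      \<open>pi\<close>, the complementary arc from \<open>b\<close> to \<open>a + 2 * pi\<close>
      turns by less.\<close>
    have "T (a + 2 * pi) = T a + 2 * pi" by (simp add: T_def c_per)
    then have "T (a + 2 * pi) - T b \<le> pi" using False by simp
    then show ?thesis using arc[OF that(2)] c_per[of a] by metis
  qed
  obtain a where a: "x = c a" "-pi < a" "a \<le> pi" using ex[of x] r_def by blast
  obtain b where b: "y = c b" "-pi < b" "b \<le> pi" using ex[of y] r_def assms(5) by auto
  have "a \<noteq> b" using a b \<open>x \<noteq> y\<close> by auto
  then consider "a < b" | "b < a" by linarith
  then show False using no[of a b] no[of b a] a b \<open>G x = G y\<close> by cases auto
qed

text \<open>Colliding pairs just beyond the supremal radius \<open>R\<close> of injectivity
  accumulate at a pair \<open>x\<close>, \<open>y\<close>. Distinct limits are excluded by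
  \<open>circ\<close> if both lie on the circle of radius \<open>R\<close>, by the choice of
  \<open>R\<close> if both lie inside, and by openness of \<open>G\<close> in the mixed case; equal
  limits contradict local injectivity.\<close>

lemma inj_on_ball_if_inj_on_circles:
  fixes G :: "complex \<Rightarrow> complex"
  assumes hol: "G holomorphic_on ball 0 1" and nz: "\<And>z. z \<in> ball 0 1 \<Longrightarrow> deriv G z \<noteq> 0"
    and circ: "\<And>x y. norm x < 1 \<Longrightarrow> norm x = norm y \<Longrightarrow> G x = G y \<Longrightarrow> x = y"
  shows "inj_on G (ball 0 1)"
proof (rule ccontr)
  assume noninj: "\<not> inj_on G (ball 0 1)"
  define B where "B = {r. 0 < r \<and> r \<le> 1 \<and> inj_on G (ball 0 r)}"
  define R where "R = Sup B"
  obtain r0 where "r0 > 0" "inj_on G (ball 0 r0)"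
    using has_complex_derivative_locally_injective[OF hol _ open_ball nz, of 0] by auto
  then have "inj_on G (ball 0 (min r0 1))" by (rule_tac inj_on_subset) auto
  with \<open>r0 > 0\<close> have "min r0 1 \<in> B" by (simp add: B_def)
  have bdd: "bdd_above B" by (rule bdd_aboveI[of _ 1]) (simp add: B_def)
  have "min r0 1 \<le> R" unfolding R_def by (rule cSup_upper[OF \<open>min r0 1 \<in> B\<close> bdd])
  then have "R > 0" using \<open>r0 > 0\<close> by linarith
  have injR: "x = y" if "norm x < R" "norm y < R" "G x = G y" for x y
  proof -
    have "max (norm x) (norm y) < Sup B" using that by (simp add: R_def)
    then obtain r where "r \<in> B" "max (norm x) (norm y) < r"
      using less_cSup_iff[of B] \<open>min r0 1 \<in> B\<close> bdd by blast
    then show ?thesis using that by (auto simp: B_def inj_on_def)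
  qed
  have "B \<noteq> {}" using \<open>min r0 1 \<in> B\<close> by blast
  then have "R \<le> 1" unfolding R_def by (rule cSup_least) (simp add: B_def)
  with injR noninj have "R < 1" by (cases "R = 1") (auto simp: inj_on_def)
  \<comment> \<open>Radii above \<open>R\<close> tending to \<open>R\<close>, capped at
    \<open>1\<close> so that the colliding pairs stay in the unit disk.\<close>
  define d where "d n = min 1 (R + 1 / real (Suc n))" for n
  have "\<exists>x y. norm x < d n \<and> norm y < d n \<and> x \<noteq> y \<and> G x = G y" for n
  proof -
    have "d n > R" using \<open>R < 1\<close> by (simp add: d_def)
    then have "d n \<notin> B" using cSup_upper[OF _ bdd] by (force simp: R_def)
    moreover have "0 < d n" "d n \<le> 1" using \<open>d n > R\<close> \<open>R > 0\<close> by (linarith, simp add: d_def)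
    ultimately have "\<not> inj_on G (ball 0 (d n))" by (simp add: B_def)
    then show ?thesis unfolding inj_on_def Ball_def mem_ball_0 by blast
  qed
  then obtain X Y where XY: "\<And>n. norm (X n) < d n" "\<And>n. norm (Y n) < d n" "\<And>n. X n \<noteq> Y n" "\<And>n. G (X n) = G (Y n)"
    by metis
  have "(X n, Y n) \<in> cball 0 1 \<times> cball 0 1" for n
    using XY(1,2)[of n] by (auto simp: d_def)
  moreover have "compact (cball (0::complex) 1 \<times> cball (0::complex) 1)" by (intro compact_Times) auto
  ultimately obtain l \<sigma> where l: "strict_mono \<sigma>" "((\<lambda>n. (X n, Y n)) \<circ> \<sigma>) \<longlonglongrightarrow> l"
    unfolding compact_def by (metis (no_types, lifting))
  obtain x y where "l = (x, y)" by force
  then have lim: "(\<lambda>n. X (\<sigma> n)) \<longlonglongrightarrow> x" "(\<lambda>n. Y (\<sigma> n)) \<longlonglongrightarrow> y"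
    using tendsto_fst[OF l(2)] tendsto_snd[OF l(2)] by (simp_all add: o_def)
  have "(\<lambda>n. R + 1 / real (Suc n)) \<longlonglongrightarrow> R + 0"
    by (intro tendsto_intros LIMSEQ_inverse_real_of_nat[unfolded inverse_eq_divide])
  then have dlim: "(\<lambda>n. R + 1 / real (Suc (\<sigma> n))) \<longlonglongrightarrow> R"
    using LIMSEQ_subseq_LIMSEQ[OF _ l(1)] by (fastforce simp: o_def)
  have dle: "d n \<le> R + 1 / real (Suc n)" for n by (simp add: d_def)
  have nx: "norm x \<le> R"
    by (rule LIMSEQ_le[OF tendsto_norm[OF lim(1)] dlim]) (use XY(1) dle in \<open>meson less_imp_le order_trans\<close>)
  have ny: "norm y \<le> R"
    by (rule LIMSEQ_le[OF tendsto_norm[OF lim(2)] dlim]) (use XY(2) dle in \<open>meson less_imp_le order_trans\<close>)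
  have xb: "x \<in> ball 0 1" and yb: "y \<in> ball 0 1" using nx ny \<open>R < 1\<close> by auto
  have cont: "isCont G z" if "z \<in> ball 0 1" for z
    using holomorphic_on_imp_differentiable_at[OF hol open_ball that] field_differentiable_imp_continuous_at by blast
  have "G x = G y"
    using isCont_tendsto_compose[OF cont[OF xb] lim(1)] isCont_tendsto_compose[OF cont[OF yb] lim(2)] XY(4)
    by (simp add: LIMSEQ_unique)
  \<comment> \<open>By openness, the points \<open>of_real s * w\<close> with \<open>s\<close>
    slightly below \<open>1\<close> take values in the image of \<open>ball u \<delta>\<close>.
    Injectivity on \<open>ball 0 R\<close> then puts them in \<open>ball u \<delta>\<close>, which
    stays away from the circle.\<close>
  have aux: False if "norm u < R" "norm w = R" "G u = G w" for u w
  proof -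
    define \<delta> where "\<delta> = (R - norm u) / 2"
    have "\<delta> > 0" using that by (simp add: \<delta>_def)
    have sub: "ball u \<delta> \<subseteq> ball 0 R"
    proof
      fix z assume "z \<in> ball u \<delta>"
      then have "norm (z - u) < \<delta>" by (simp add: dist_norm norm_minus_commute)
      then show "z \<in> ball 0 R" using norm_triangle_sub[of z u] that by (simp add: \<delta>_def field_simps)
    qed
    have "open (G ` ball u \<delta>)"
    proof (rule open_mapping_thm3)
      show "G holomorphic_on ball u \<delta>"
        by (rule holomorphic_on_subset[OF hol order_trans[OF sub]]) (use \<open>R < 1\<close> in auto)
      show "inj_on G (ball u \<delta>)" using injR sub by (auto simp: inj_on_def subset_iff)
    qed auto
    moreover have "G w \<in> G ` ball u \<delta>" using \<open>\<delta> > 0\<close> by (simp flip: that(3))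
    moreover have "((\<lambda>s. of_real s * w) \<longlongrightarrow> of_real 1 * w) (at_left 1)"
      by (intro tendsto_intros)
    then have "((\<lambda>s. G (of_real s * w)) \<longlongrightarrow> G w) (at_left 1)"
      by (intro isCont_tendsto_compose[OF cont]) (use that \<open>R < 1\<close> in auto)
    ultimately have "eventually (\<lambda>s. G (of_real s * w) \<in> G ` ball u \<delta>) (at_left (1::real))"
      by (intro topological_tendstoD[of _ "G w"]) auto
    \<comment> \<open>Beyond this threshold \<open>s * R\<close> exceeds
      \<open>(R + norm u) / 2 = norm u + \<delta>\<close>.\<close>
    moreover have "eventually (\<lambda>s. (R + norm u) / (2 * R) < s) (at_left (1::real))"
      using that \<open>R > 0\<close> by (intro order_tendstoD(1)[OF tendsto_ident_at]) (simp add: field_simps)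
    moreover have "eventually (\<lambda>s. s < 1) (at_left (1::real))"
      by (simp add: eventually_at_filter)
    ultimately have "eventually (\<lambda>s. False) (at_left (1::real))"
    proof eventually_elim
      case (elim s)
      then obtain z where z: "z \<in> ball u \<delta>" "G (of_real s * w) = G z" by blast
      have "0 \<le> (R + norm u) / (2 * R)" using \<open>R > 0\<close> by simp
      then have "s > 0" using elim by linarith
      have nsw: "norm (of_real s * w) = s * R" using \<open>s > 0\<close> that by (simp add: norm_mult)
      have "of_real s * w = z"
        using injR[of "of_real s * w" z] z sub nsw elim \<open>R > 0\<close> by (auto simp: subset_iff)
      then have "norm (of_real s * w - u) < \<delta>" using z by (simp add: dist_norm norm_minus_commute)
      then have "s * R < norm u + \<delta>" using norm_triangle_sub[of "of_real s * w" u] nsw by linarith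
      moreover have "s * R > (R + norm u) / 2" using elim \<open>R > 0\<close> by (simp add: field_simps)
      ultimately show False by (simp add: \<delta>_def field_simps)
    qed
    then show False by simp
  qed
  show False
  proof (cases "x = y")
    case False
    then show False using aux[of x y] aux[of y x] circ[of x y] injR[of x y] nx ny xb \<open>G x = G y\<close>
      by (cases "norm x = R"; cases "norm y = R") auto
  next
    case True
    obtain \<rho> where \<rho>: "\<rho> > 0" "inj_on G (ball x \<rho>)"
      using has_complex_derivative_locally_injective[OF hol xb open_ball nz[OF xb]] by metis
    have "eventually (\<lambda>n. X (\<sigma> n) \<in> ball x \<rho>) sequentially" "eventually (\<lambda>n. Y (\<sigma> n) \<in> ball x \<rho>) sequentially"
      using lim True \<rho>(1) by (auto intro!: topological_tendstoD[OF _ open_ball] simp del: mem_ball)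
    then have "eventually (\<lambda>n. False) sequentially"
      by eventually_elim (use \<rho>(2) XY(3,4) in \<open>meson inj_onD\<close>)
    then show False by simp
  qed
qed

section \<open>Starlike functions and subordination\<close>

locale starlike_univalent =
  fixes g :: "complex \<Rightarrow> complex"
  assumes hol: "g holomorphic_on ball 0 1" and inj: "inj_on g (ball 0 1)" and g0 [simp]: "g 0 = 0"
    and star: "\<And>z t. z \<in> ball 0 1 \<Longrightarrow> 0 \<le> t \<Longrightarrow> t \<le> 1 \<Longrightarrow> of_real t * g z \<in> g ` ball 0 1"
begin

lemma deriv_nonzero: "z \<in> ball 0 1 \<Longrightarrow> deriv g z \<noteq> 0"
  using holomorphic_injective_imp_regular[OF hol open_ball inj] .

text \<open>The Schwarz lemma for \<open>\<psi> (of_real t * g z)\<close>, with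
  \<open>\<psi>\<close> the inverse of \<open>g\<close>: by starlikeness this is a self-map of the
  disk, and it fixes the origin.\<close>

lemma norm_le_if_scaled:
  assumes "z \<in> ball 0 1" "w \<in> ball 0 1" "0 \<le> t" "t \<le> 1" "g w = of_real t * g z"
  shows "norm w \<le> norm z"
proof -
  obtain \<psi> where \<psi>: "\<psi> holomorphic_on g ` ball 0 1" "\<And>z. z \<in> ball 0 1 \<Longrightarrow> \<psi> (g z) = z"
    using holomorphic_has_inverse[OF hol open_ball inj] by metis
  have sub: "(\<lambda>z. of_real t * g z) ` ball 0 1 \<subseteq> g ` ball 0 1" using star assms by blast
  have "norm (\<psi> (of_real t * g z)) \<le> norm z"
  proof (rule Schwarz_Lemma(1)[of "\<lambda>z. \<psi> (of_real t * g z)"])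
    have "(\<lambda>z. of_real t * g z) holomorphic_on ball 0 1" by (intro holomorphic_intros hol)
    from holomorphic_on_compose_gen[OF this \<psi>(1) sub]
    show "(\<lambda>z. \<psi> (of_real t * g z)) holomorphic_on ball 0 1" by (simp add: o_def)
    show "\<psi> (of_real t * g 0) = 0" using \<psi>(2)[of 0] by simp
    fix z :: complex assume "norm z < 1"
    then obtain y where "y \<in> ball 0 1" "of_real t * g z = g y" using sub by (smt (verit) image_iff image_subset_iff mem_ball_0)
    then show "norm (\<psi> (of_real t * g z)) < 1" using \<psi>(2) by auto
  qed (use assms in auto)
  then show ?thesis using \<psi>(2)[of w] assms by (metis)
qed

text \<open>Shrinking the value \<open>g z\<close> by \<open>exp (- s)\<close> moves its preimage
  along a curve that stays in \<open>cball 0 (norm z)\<close>. The initial velocity of this curve,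
  divided by \<open>z\<close>, is minus the quotient.\<close>

lemma Re_quotient_nonneg:
  assumes z: "z \<in> ball 0 1" "z \<noteq> 0"
  shows "Re (g z / (z * deriv g z)) \<ge> 0"
proof -
  obtain \<psi> where \<psi>: "\<psi> holomorphic_on g ` ball 0 1" "\<And>z. z \<in> ball 0 1 \<Longrightarrow> \<psi> (g z) = z"
      "\<And>z. z \<in> ball 0 1 \<Longrightarrow> deriv g z * deriv \<psi> (g z) = 1"
    using holomorphic_has_inverse[OF hol open_ball inj] by metis
  have "open (g ` ball 0 1)" by (rule open_mapping_thm3[OF hol open_ball inj])
  then have d\<psi>: "(\<psi> has_field_derivative deriv \<psi> (g z)) (at (g z))"
    using \<psi>(1) z by (intro holomorphic_derivI) auto
  have "Re (- (deriv \<psi> (g z) * g z / z)) \<le> 0"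
  proof (rule Re_deriv_nonpos_if_norm_le_start)
    define V where "V s = \<psi> (of_real (exp (- s)) * g z) / z" for s
    have e: "((\<lambda>s. exp (-s) * g z) has_field_derivative - g z) (at (of_real 0))"
      by (auto intro!: derivative_eq_intros)
    have "((\<lambda>s. \<psi> (exp (-s) * g z) / z) has_field_derivative deriv \<psi> (g z) * - g z / z) (at (of_real 0))"
      by (intro DERIV_cdivide DERIV_chain2[OF _ e]) (simp add: d\<psi>)
    from has_vector_derivative_real_field[OF this]
    show "(V has_vector_derivative - (deriv \<psi> (g z) * g z / z)) (at 0)"
      by (simp add: V_def[abs_def] exp_of_real[symmetric])
    show "V 0 = 1" using \<psi>(2) z by (simp add: V_def)
    fix s :: real assume "s \<ge> 0"
    then obtain w where w: "w \<in> ball 0 1" "of_real (exp (- s)) * g z = g w"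
      using star[OF z(1), of "exp (-s)"] by auto
    have "norm w \<le> norm z"
      using norm_le_if_scaled[OF z(1) w(1), of "exp (-s)"] w(2) \<open>s \<ge> 0\<close> by simp
    then show "norm (V s) \<le> 1"
      using z w \<psi>(2)[of w] by (simp add: V_def norm_divide)
  qed
  moreover have "deriv \<psi> (g z) = 1 / deriv g z"
    using \<psi>(3)[OF z(1)] deriv_nonzero[OF z(1)] by (simp add: field_simps)
  ultimately show ?thesis by (simp add: mult.commute)
qed

text \<open>The reciprocal quotient extends to a holomorphic \<open>h\<close> with
  \<open>h 0 = 1\<close> and nonnegative real part. By the open mapping theorem a nonconstant
  \<open>h\<close> never has real part zero, and inversion preserves the sign of the real
  part.\<close>

lemma Re_quotient_pos:
  assumes z: "z \<in> ball 0 1" "z \<noteq> 0"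
  shows "Re (z * deriv g z / g z) > 0"
proof -
  obtain q where q: "q holomorphic_on ball 0 1" "\<And>z. norm z < 1 \<Longrightarrow> g z = z * q z" "deriv g 0 = q 0"
    using Schwarz3[OF hol g0] by metis
  define h where "h z = q z / deriv g z" for z
  have holh: "h holomorphic_on ball 0 1" unfolding h_def
    by (intro holomorphic_intros q holomorphic_deriv hol) (use deriv_nonzero in auto)
  have "h 0 = 1" using q(3) deriv_nonzero[of 0] by (simp add: h_def)
  have hq: "h z = g z / (z * deriv g z)" if "norm z < 1" "z \<noteq> 0" for z
    using q(2)[of z] that by (simp add: h_def)
  have nn: "Re (h z) \<ge> 0" if "z \<in> ball 0 1" for z
    using Re_quotient_nonneg[of z] hq[of z] that \<open>h 0 = 1\<close> by (cases "z = 0") auto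
  have "Re (h z) > 0"
  proof (cases "h constant_on ball 0 1")
    case True
    then have "h z = h 0" using z by (auto simp: constant_on_def)
    then show ?thesis using \<open>h 0 = 1\<close> by simp
  next
    case False
    then have "open (h ` ball 0 1)"
      by (intro open_mapping_thm[OF holh open_ball connected_ball]) auto
    then obtain e where e: "e > 0" "ball (h z) e \<subseteq> h ` ball 0 1"
      using z(1) unfolding open_contains_ball by blast
    have "h z - of_real (e/2) \<in> ball (h z) e" using e(1) by (simp add: dist_norm)
    then obtain y where "y \<in> ball 0 1" "h z - of_real (e/2) = h y" using e(2) by blast
    then have "Re (h z) - e/2 \<ge> 0" using nn[of y] by (metis Re_complex_of_real minus_complex.sel(1))
    then show ?thesis using e(1) by linarith
  qed
  moreover have "z * deriv g z / g z = inverse (h z)"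
    using hq[of z] z by (simp add: field_simps)
  ultimately show ?thesis
    by (auto intro!: divide_pos_pos add_pos_nonneg)
qed

text \<open>The quotient \<open>g z / z\<close> has no zeros: at the origin it is
  \<open>deriv g 0\<close>, elsewhere injectivity applies. The logarithm supplies the tangent angle
  used for univalence.\<close>

lemma log_quotient_exists:
  obtains L where "L holomorphic_on ball 0 1" "\<And>z. z \<in> ball 0 1 \<Longrightarrow> g z = z * exp (L z)"
proof -
  obtain q where q: "q holomorphic_on ball 0 1" "\<And>z. norm z < 1 \<Longrightarrow> g z = z * q z" "deriv g 0 = q 0"
    using Schwarz3[OF hol g0] by metis
  have "q z \<noteq> 0" if "z \<in> ball 0 1" for z
  proof (cases "z = 0")
    case True then show ?thesis using q(3) deriv_nonzero[of 0] by auto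
  next
    case False
    then have "g z \<noteq> g 0" using inj that by (auto simp: inj_on_def)
    then show ?thesis using q(2)[of z] that by auto
  qed
  then obtain L where "L holomorphic_on ball 0 1" "\<And>z. z \<in> ball 0 1 \<Longrightarrow> q z = exp (L z)"
    using contractible_imp_holomorphic_log[OF q(1)] convex_imp_contractible[OF convex_ball] by metis
  then show ?thesis using that q(2) by auto
qed

end

section \<open>Subordination to the convex integral \<open>G\<close>\<close>

context starlike_univalent
begin

text \<open>Here \<open>v z = H (F z)\<close> with \<open>H\<close> the inverse of \<open>G\<close>.
  On disks that \<open>F\<close> maps into the range of \<open>G\<close>, Jack's lemma bounds
  \<open>norm (v z)\<close> by \<open>norm z\<close>; this bound in turn prevents \<open>F\<close>
  from ever leaving that range.\<close>

lemma subordinate_integral: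
  assumes holL: "L holomorphic_on ball 0 1" and gL: "\<And>z. z \<in> ball 0 1 \<Longrightarrow> g z = z * exp (L z)"
    and dG: "\<And>z. z \<in> ball 0 1 \<Longrightarrow> (G has_field_derivative exp (L z)) (at z)"
    and holF: "F holomorphic_on ball 0 1" and FG0: "F 0 = G 0"
    and sub: "\<And>z. z \<in> ball 0 1 \<Longrightarrow> z * deriv F z \<in> g ` ball 0 1"
  obtains v where "v holomorphic_on ball 0 1" "\<And>z. norm z < 1 \<Longrightarrow> norm (v z) \<le> norm z"
    "\<And>z. z \<in> ball 0 1 \<Longrightarrow> F z = G (v z)"
proof -
  have holG: "G holomorphic_on ball 0 1"
    using dG by (meson field_differentiable_at_within field_differentiable_def holomorphic_on_def)
  have dG': "deriv G z = exp (L z)" if "z \<in> ball 0 1" for z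
    using dG[OF that] by (rule DERIV_imp_deriv)
  have injG: "inj_on G (ball 0 1)"
  proof (rule inj_on_ball_if_inj_on_circles[OF holG])
    \<comment> \<open>Logarithmic differentiation of \<open>g z = z * exp (L z)\<close> gives
      \<open>z * deriv g z / g z = 1 + z * deriv L z\<close>, so starlikeness of \<open>g\<close>
      becomes convexity of \<open>G\<close>.\<close>
    have "Re (1 + z * deriv L z) > 0" if z: "z \<in> ball 0 1" for z
    proof (cases "z = 0")
      case False
      have "((\<lambda>z. z * exp (L z)) has_field_derivative exp (L z) * (1 + z * deriv L z)) (at z)"
        using holomorphic_derivI[OF holL open_ball z]
        by (auto intro!: derivative_eq_intros simp: algebra_simps)
      then have "(g has_field_derivative exp (L z) * (1 + z * deriv L z)) (at z)"
        by (rule has_field_derivative_transform_within_open[OF _ open_ball z]) (simp add: gL)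
      then have "deriv g z = exp (L z) * (1 + z * deriv L z)" by (rule DERIV_imp_deriv)
      then show ?thesis using Re_quotient_pos[OF z False] gL[OF z] False by simp
    qed simp
    then show "\<And>x y. norm x < 1 \<Longrightarrow> norm x = norm y \<Longrightarrow> G x = G y \<Longrightarrow> x = y"
      using convex_univalent_on_circle[OF holL dG] by blast
  qed (simp add: dG')
  obtain H where H: "H holomorphic_on G ` ball 0 1" "\<And>z. z \<in> ball 0 1 \<Longrightarrow> H (G z) = z"
    using holomorphic_has_inverse[OF holG open_ball injG] by metis
  have openG: "open (G ` ball 0 1)" by (rule open_mapping_thm3[OF holG open_ball injG])
  obtain \<psi> where \<psi>: "\<psi> holomorphic_on g ` ball 0 1" "\<And>z. z \<in> ball 0 1 \<Longrightarrow> \<psi> (g z) = z"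
    using holomorphic_has_inverse[OF hol open_ball inj] by metis
  define \<omega> where "\<omega> z = \<psi> (z * deriv F z)" for z
  have \<omega>: "\<omega> z \<in> ball 0 1" "g (\<omega> z) = z * deriv F z" if "z \<in> ball 0 1" for z
    using sub[OF that] \<psi>(2) by (auto simp: \<omega>_def)
  have "(\<lambda>z. z * deriv F z) holomorphic_on ball 0 1"
    by (intro holomorphic_intros holomorphic_deriv holF) auto
  from holomorphic_on_compose_gen[OF this \<psi>(1)] have "\<omega> holomorphic_on ball 0 1"
    using sub by (simp add: \<omega>_def[abs_def] o_def image_subset_iff)
  then have \<omega>_le: "norm (\<omega> z) \<le> norm z" if "norm z < 1" for z
    using Schwarz_Lemma(1)[of \<omega> z] \<omega>(1) that \<psi>(2)[of 0] by (auto simp: \<omega>_def)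

  \<comment> \<open>The radius \<open>R\<close> is left free, since the inclusion of ranges is not
    yet known on the whole disk.\<close>
  have step: "norm (H (F z)) \<le> norm z"
    if R: "R \<le> 1" "F ` ball 0 R \<subseteq> G ` ball 0 1" and z: "norm z < R" for R z
  proof -
    define v where "v z = H (F z)" for z
    have v: "v z \<in> ball 0 1" "G (v z) = F z" if zR: "z \<in> ball 0 R" for z
    proof -
      obtain u where "u \<in> ball 0 1" "F z = G u" using subsetD[OF R(2) imageI[OF zR]] by (rule imageE)
      then show "v z \<in> ball 0 1" "G (v z) = F z" using H(2) by (simp_all add: v_def)
    qed
    have "F holomorphic_on ball 0 R"
      using holF R(1) by (auto intro: holomorphic_on_subset)
    from holomorphic_on_compose_gen[OF this H(1) R(2)]
    have holv: "v holomorphic_on ball 0 R" by (simp add: v_def[abs_def] o_def)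
    have "v 0 = 0" using H(2)[of 0] FG0 by (simp add: v_def)
    have "compact (cball (0::complex) (norm z))" "cball (0::complex) (norm z) \<noteq> {}" by auto
    moreover have "continuous_on (cball 0 (norm z)) (\<lambda>x. norm (v x))"
      by (intro continuous_on_norm continuous_on_subset[OF holomorphic_on_imp_continuous_on[OF holv]])
         (use z in auto)
    ultimately obtain z0 where z0: "norm z0 \<le> norm z" "\<And>x. norm x \<le> norm z \<Longrightarrow> norm (v x) \<le> norm (v z0)"
      using continuous_attains_sup[of "cball 0 (norm z)" "\<lambda>x. norm (v x)"] by auto
    have z0R: "z0 \<in> ball 0 R" and z01: "z0 \<in> ball 0 1" using z0(1) z R(1) by auto
    have "norm (v z0) \<le> norm z0"
    proof (cases "v z0 = 0")
      case False
      obtain m :: real where m: "m \<ge> 1" "z0 * deriv v z0 = of_real m * v z0"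
        using Jack_lemma[OF holv \<open>v 0 = 0\<close> z0R False] z0 by (metis order_trans)
      have "((\<lambda>z. G (v z)) has_field_derivative exp (L (v z0)) * deriv v z0) (at z0)"
        by (rule DERIV_chain2[OF dG[OF v(1)[OF z0R]] holomorphic_derivI[OF holv open_ball z0R]])
      then have "(F has_field_derivative exp (L (v z0)) * deriv v z0) (at z0)"
        by (rule has_field_derivative_transform_within_open[OF _ open_ball z0R]) (simp add: v)
      then have "deriv F z0 = exp (L (v z0)) * deriv v z0" by (rule DERIV_imp_deriv)
      then have "g (\<omega> z0) = exp (L (v z0)) * (z0 * deriv v z0)" using \<omega>(2)[OF z01] by simp
      also have "\<dots> = of_real m * g (v z0)" using gL[OF v(1)[OF z0R]] m(2) by simp
      \<comment> \<open>As \<open>1 / m \<le> 1\<close>, the value at \<open>v z0\<close> is a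
        radial shrinking of the value at \<open>\<omega> z0\<close>.\<close>
      finally have "g (v z0) = of_real (1 / m) * g (\<omega> z0)" using m(1) by simp
      then have "norm (v z0) \<le> norm (\<omega> z0)"
        using norm_le_if_scaled[OF \<omega>(1)[OF z01] v(1)[OF z0R], of "1/m"] m(1) by simp
      then show ?thesis using \<omega>_le[of z0] z01 by simp
    qed simp
    then show ?thesis using z0(2)[of z] z0(1) by (simp add: v_def)
  qed

  have incl: "F ` ball 0 1 \<subseteq> G ` ball 0 1"
  proof (rule ccontr)
    assume "\<not> ?thesis"
    then obtain z' where z': "norm z' < 1" "F z' \<notin> G ` ball 0 1"
      unfolding image_subset_iff Ball_def mem_ball_0 by blast
    \<comment> \<open>The points where \<open>F\<close> is outside the range of \<open>G\<close>;
      this set is closed because the range is open, so it has a point \<open>z1\<close> of least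
      modulus.\<close>
    define S where "S = cball 0 (norm z') \<inter> F -` (- (G ` ball 0 1))"
    have "closed S" unfolding S_def
      by (intro continuous_closed_preimage continuous_on_subset[OF holomorphic_on_imp_continuous_on[OF holF]])
         (use z' openG in auto)
    moreover have "z' \<in> S" using z' by (simp add: S_def)
    ultimately obtain z1 where z1: "z1 \<in> S" "\<And>y. y \<in> S \<Longrightarrow> norm z1 \<le> norm y"
      using distance_attains_inf[of S 0] by (auto simp: dist_norm)
    define R where "R = norm z1"
    have R1: "R < 1" using z1(1) z' by (simp add: S_def R_def)
    have notin: "F z1 \<notin> G ` ball 0 1" using z1(1) by (simp add: S_def)
    have "z1 \<noteq> 0" using notin FG0 by force
    then have "R > 0" by (simp add: R_def)
    have subR: "F ` ball 0 R \<subseteq> G ` ball 0 1"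
    proof (rule ccontr)
      assume "\<not> ?thesis"
      then obtain y where "norm y < R" "F y \<notin> G ` ball 0 1"
        unfolding image_subset_iff Ball_def mem_ball_0 by blast
      moreover have "R \<le> norm z'" using z1(2)[OF \<open>z' \<in> S\<close>] by (simp add: R_def)
      ultimately have "y \<in> S" by (simp add: S_def)
      then show False using z1(2) \<open>norm y < R\<close> by (force simp: R_def)
    qed
    \<comment> \<open>The bound from \<open>step\<close> confines \<open>F\<close> on this disk to a
      compact part of the range of \<open>G\<close>, which must then contain the limit value
      \<open>F z1\<close>.\<close>
    have "F ` ball 0 R \<subseteq> G ` cball 0 R"
    proof
      fix w assume "w \<in> F ` ball 0 R"
      then obtain y where y: "norm y < R" "w = F y" by auto
      then obtain u where u: "u \<in> ball 0 1" "F y = G u" using subsetD[OF subR imageI, of y] by auto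
      have "norm u \<le> norm y" using step[OF _ subR y(1)] R1 u H(2)[OF u(1)] by simp
      then show "w \<in> G ` cball 0 R" using y u by auto
    qed
    moreover have "closed (G ` cball 0 R)"
      by (intro compact_imp_closed compact_continuous_image
          continuous_on_subset[OF holomorphic_on_imp_continuous_on[OF holG]]) (use R1 in auto)
    moreover have "continuous_on (closure (ball 0 R)) F"
      by (rule continuous_on_subset[OF holomorphic_on_imp_continuous_on[OF holF]]) (use R1 \<open>R > 0\<close> in auto)
    ultimately have "F ` closure (ball 0 R) \<subseteq> G ` cball 0 R"
      by (intro image_closure_subset)
    moreover have "z1 \<in> closure (ball 0 R)" using \<open>R > 0\<close> by (simp add: R_def)
    ultimately show False using notin R1 by force
  qed
  show ?thesis
  proof (rule that[of "\<lambda>z. H (F z)"])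
    show "(\<lambda>z. H (F z)) holomorphic_on ball 0 1"
      using holomorphic_on_compose_gen[OF holF H(1) incl] by (simp add: o_def)
    show "norm (H (F z)) \<le> norm z" if "norm z < 1" for z using step[OF _ incl that] by simp
    show "F z = G (H (F z))" if z1: "z \<in> ball 0 1" for z
    proof -
      obtain u where "u \<in> ball 0 1" "F z = G u" using subsetD[OF incl imageI[OF z1]] by (rule imageE)
      then show ?thesis using H(2) by simp
    qed
  qed
qed

end

section \<open>The extremal function, and arclength as an energy\<close>

lemma contour_integral_linepath_quotient:
  assumes q: "\<And>z. z \<in> ball 0 1 \<Longrightarrow> \<phi> z - 1 = z * q z"
    and dG: "\<And>z. z \<in> ball 0 1 \<Longrightarrow> (G has_field_derivative q z) (at z)" and "G 0 = 0"
    and t: "t \<in> ball 0 1"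
  shows "contour_integral (linepath 0 t) (\<lambda>\<zeta>. (\<phi> \<zeta> - 1) / \<zeta>) = G t"
proof (cases "t = 0")
  case False
  have seg: "linepath 0 t x \<in> ball 0 1" if "x \<in> {0..1}" for x
  proof -
    have "linepath 0 t x \<in> closed_segment 0 t" using that by (rule linepath_in_path)
    also have "\<dots> \<subseteq> ball 0 1" using t by (intro closed_segment_subset) auto
    finally show ?thesis .
  qed
  have "(q has_contour_integral G (pathfinish (linepath 0 t)) - G (pathstart (linepath 0 t))) (linepath 0 t)"
    by (rule contour_integral_primitive[of "ball 0 1", OF _ valid_path_linepath])
       (use dG seg in \<open>auto intro: has_field_derivative_at_within simp only: path_image_def\<close>)
  then have "((\<lambda>x. q (linepath 0 t x) * (t - 0)) has_integral G t) {0..1}"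
    using \<open>G 0 = 0\<close> by (simp add: has_contour_integral_linepath)
  \<comment> \<open>At parameter \<open>0\<close> the quotient is a division by zero with value
    \<open>0\<close> in place of \<open>q 0\<close>; one point does not affect the integral.\<close>
  then have "((\<lambda>x. (\<phi> (linepath 0 t x) - 1) / linepath 0 t x * (t - 0)) has_integral G t) {0..1}"
  proof (rule has_integral_spike_finite[of "{0}", rotated 2])
    fix x :: real assume x: "x \<in> {0..1} - {0}"
    then have "linepath 0 t x \<noteq> 0" using False by (simp add: linepath_def)
    moreover have "\<phi> (linepath 0 t x) - 1 = linepath 0 t x * q (linepath 0 t x)"
      using q[OF seg, of x] x by blast
    ultimately show "(\<phi> (linepath 0 t x) - 1) / linepath 0 t x * (t - 0) = q (linepath 0 t x) * (t - 0)"
      by (metis nonzero_mult_div_cancel_left)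
  qed simp
  then show ?thesis
    by (intro contour_integral_unique) (simp add: has_contour_integral_linepath)
qed (simp add: \<open>G 0 = 0\<close>)

text \<open>The outer line integral integrates \<open>exp (G z)\<close> along radii, so on the disk
  \<open>k_fun \<phi>\<close> coincides with a primitive \<open>P\<close> of that function.\<close>

lemma has_field_derivative_k_fun:
  assumes q: "\<And>z. z \<in> ball 0 1 \<Longrightarrow> \<phi> z - 1 = z * q z"
    and dG: "\<And>z. z \<in> ball 0 1 \<Longrightarrow> (G has_field_derivative q z) (at z)" and "G 0 = 0"
    and z: "z \<in> ball 0 1"
  shows "(k_fun \<phi> has_field_derivative exp (G z)) (at z)"
proof -
  have "G holomorphic_on ball 0 1" using dG by (meson field_differentiable_at_within field_differentiable_def holomorphic_on_def)
  then have "(\<lambda>z. exp (G z)) holomorphic_on ball 0 1" by (intro holomorphic_intros)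
  then obtain P where P: "P 0 = 0" "\<And>z. z \<in> ball 0 1 \<Longrightarrow> (P has_field_derivative exp (G z)) (at z)"
    using holomorphic_primitive_ball by (metis zero_less_one)
  have "P z = k_fun \<phi> z" if "z \<in> ball 0 1" for z
  proof -
    have seg: "closed_segment 0 z \<subseteq> ball 0 1" using that by (intro closed_segment_subset) auto
    have "((\<lambda>z. exp (G z)) has_contour_integral P (pathfinish (linepath 0 z)) - P (pathstart (linepath 0 z)))
        (linepath 0 z)"
      by (rule contour_integral_primitive[of "ball 0 1", OF _ valid_path_linepath])
         (use P(2) seg in \<open>auto intro: has_field_derivative_at_within simp only: path_image_linepath\<close>)
    then have "contour_integral (linepath 0 z) (\<lambda>z. exp (G z)) = P z"
      using P(1) by (intro contour_integral_unique) simp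
    moreover have "k_fun \<phi> z = contour_integral (linepath 0 z) (\<lambda>z. exp (G z))"
      unfolding k_fun_def using seg
      by (intro contour_integral_eq arg_cong[of _ _ exp] contour_integral_linepath_quotient[OF q dG \<open>G 0 = 0\<close>])
         (auto simp only: path_image_linepath)
    ultimately show ?thesis by simp
  qed
  then show ?thesis
    by (rule has_field_derivative_transform_within_open[OF P(2)[OF z] open_ball z])
qed

lemma arclen_eq_circle_energy:
  assumes "\<And>z. z \<in> ball 0 1 \<Longrightarrow> deriv f z = exp (F z)" and "0 < r" "r < 1"
  shows "arclen f r = r * circle_energy (\<lambda>z. exp (F z / 2)) r"
proof -
  have "norm (deriv f (of_real r * cis t)) = (norm (exp (F (of_real r * cis t) / 2)))\<^sup>2" for t
    using assms by (simp flip: norm_power exp_double)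
  then show ?thesis by (simp add: arclen_def circle_energy_def)
qed

text \<open>Littlewood's inequality for the rotation by \<open>\<epsilon>\<close> and for its
  inverse, the rotation by \<open>cnj \<epsilon>\<close>.\<close>

lemma circle_energy_rotate:
  assumes hol: "K holomorphic_on ball 0 1" and r: "0 < r" "r < 1" and \<epsilon>: "norm \<epsilon> = 1"
  shows "circle_energy (\<lambda>z. K (\<epsilon> * z)) r = circle_energy K r"
proof (rule antisym)
  show "circle_energy (\<lambda>z. K (\<epsilon> * z)) r \<le> circle_energy K r"
    by (rule Littlewood_inequality[OF _ hol r]) (auto intro!: holomorphic_intros simp: norm_mult \<epsilon>)
  have "(*) \<epsilon> ` ball 0 1 \<subseteq> ball 0 1" by (auto simp: norm_mult \<epsilon>)
  then have "(\<lambda>z. K (\<epsilon> * z)) holomorphic_on ball 0 1"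
    using holomorphic_on_compose_gen[OF _ hol, of "(*) \<epsilon>" "ball 0 1"] by (auto simp: o_def intro!: holomorphic_intros)
  then have "circle_energy (\<lambda>z. K (\<epsilon> * (cnj \<epsilon> * z))) r \<le> circle_energy (\<lambda>z. K (\<epsilon> * z)) r"
    by (intro Littlewood_inequality[of "\<lambda>z. cnj \<epsilon> * z" "\<lambda>z. K (\<epsilon> * z)"] r)
       (auto intro!: holomorphic_intros simp: norm_mult \<epsilon>)
  moreover have "\<epsilon> * cnj \<epsilon> = 1" using \<epsilon> by (simp add: complex_norm_square[symmetric])
  ultimately show "circle_energy K r \<le> circle_energy (\<lambda>z. K (\<epsilon> * z)) r"
    by (simp flip: mult.assoc)
qed

section \<open>Length comparison and its equality case\<close>

theorem theorem1:
  fixes \<Omega> :: "complex set" and \<phi> :: "complex \<Rightarrow> complex"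
  assumes "open \<Omega>" and "connected \<Omega>" and "simply_connected \<Omega>"
    and "1 \<in> \<Omega>" and "\<Omega> \<noteq> UNIV"
    and "is_riemann_map \<Omega> \<phi>"
    and "starlike_wrt \<Omega> 1"
  shows "\<forall>f\<in>conv_class \<Omega>. \<forall>r. 0 < r \<and> r < 1 \<longrightarrow>
           arclen f r \<le> arclen (k_fun \<phi>) r \<and>
           (arclen f r = arclen (k_fun \<phi>) r \<longleftrightarrow>
              (\<exists>\<epsilon>. norm \<epsilon> = 1 \<and> (\<forall>z\<in>ball 0 1. f z = cnj \<epsilon> * k_fun \<phi> (\<epsilon> * z))))"
proof (intro ballI allI impI)
  fix f and r :: real
  assume f: "f \<in> conv_class \<Omega>" and "0 < r \<and> r < 1"
  then have r: "0 < r" "r < 1" by auto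
  define g where "g z = \<phi> z - 1" for z
  have \<phi>: "\<phi> holomorphic_on ball 0 1" "inj_on \<phi> (ball 0 1)" "\<phi> ` ball 0 1 = \<Omega>" "\<phi> 0 = 1"
    using \<open>is_riemann_map \<Omega> \<phi>\<close> by (auto simp: is_riemann_map_def)
  have g_image: "w \<in> g ` ball 0 1 \<longleftrightarrow> 1 + w \<in> \<Omega>" for w
    unfolding \<phi>(3)[symmetric] g_def by (auto simp: image_iff algebra_simps)
  interpret starlike_univalent g
  proof
    show "g holomorphic_on ball 0 1" unfolding g_def by (intro holomorphic_intros \<phi>)
    show "inj_on g (ball 0 1)" using \<phi>(2) by (auto simp: g_def inj_on_def)
    show "g 0 = 0" by (simp add: g_def \<phi>)
    fix z :: complex and t :: real assume zt: "z \<in> ball 0 1" "0 \<le> t" "t \<le> 1"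
    then have "closed_segment 1 (\<phi> z) \<subseteq> \<Omega>"
      using \<open>starlike_wrt \<Omega> 1\<close> \<phi>(3) by (auto simp: starlike_wrt_def)
    moreover have "1 + of_real t * g z \<in> closed_segment 1 (\<phi> z)"
      using zt unfolding closed_segment_def
      by (auto simp: g_def scaleR_conv_of_real algebra_simps intro!: exI[of _ t])
    ultimately show "of_real t * g z \<in> g ` ball 0 1" using g_image by blast
  qed
  obtain L where L: "L holomorphic_on ball 0 1" "\<And>z. z \<in> ball 0 1 \<Longrightarrow> g z = z * exp (L z)"
    using log_quotient_exists by metis
  have "(\<lambda>z. exp (L z)) holomorphic_on ball 0 1" by (intro holomorphic_intros L)
  then obtain G where G0: "G 0 = 0" and dG: "\<And>z. z \<in> ball 0 1 \<Longrightarrow> (G has_field_derivative exp (L z)) (at z)"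
    using holomorphic_primitive_ball by (metis zero_less_one)
  have holG: "G holomorphic_on ball 0 1" using dG by (meson field_differentiable_at_within field_differentiable_def holomorphic_on_def)
  have dk: "(k_fun \<phi> has_field_derivative exp (G z)) (at z)" if "z \<in> ball 0 1" for z
    using has_field_derivative_k_fun[OF _ dG G0 that] L(2) by (simp add: g_def)
  have k0: "k_fun \<phi> 0 = 0" by (simp add: k_fun_def)
  have holf: "f holomorphic_on ball 0 1" and f0: "f 0 = 0" "deriv f 0 = 1"
    and f': "\<And>z. z \<in> ball 0 1 \<Longrightarrow> deriv f z \<noteq> 0"
    and f'': "\<And>z. z \<in> ball 0 1 \<Longrightarrow> 1 + z * deriv (deriv f) z / deriv f z \<in> \<Omega>"
    using f by (auto simp: conv_class_def)
  have "deriv f holomorphic_on ball 0 1" by (intro holomorphic_deriv holf open_ball)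
  then obtain F0 where F0: "F0 holomorphic_on ball 0 1" "\<And>z. z \<in> ball 0 1 \<Longrightarrow> deriv f z = exp (F0 z)"
    using contractible_imp_holomorphic_log[OF _ convex_imp_contractible[OF convex_ball]] f' by metis
  \<comment> \<open>Since \<open>exp (F0 0) = deriv f 0 = 1\<close>, this shift leaves the
    exponential unchanged and gives \<open>F 0 = G 0\<close>.\<close>
  define F where "F z = F0 z - F0 0" for z
  have holF: "F holomorphic_on ball 0 1" unfolding F_def by (intro holomorphic_intros F0)
  have eF: "deriv f z = exp (F z)" if "z \<in> ball 0 1" for z
    using F0(2)[OF that] F0(2)[of 0] f0 by (simp add: F_def exp_diff)
  \<comment> \<open>Differentiating \<open>deriv f z = exp (F z)\<close> shows that
    \<open>z * deriv F z\<close> is the quotient constrained by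
    \<open>conv_class \<Omega>\<close>.\<close>
  have sub: "z * deriv F z \<in> g ` ball 0 1" if z: "z \<in> ball 0 1" for z
  proof -
    have "((\<lambda>z. exp (F z)) has_field_derivative exp (F z) * deriv F z) (at z)"
      using holomorphic_derivI[OF holF open_ball z] by (rule DERIV_fun_exp)
    then have "(deriv f has_field_derivative exp (F z) * deriv F z) (at z)"
      by (rule has_field_derivative_transform_within_open[OF _ open_ball z]) (simp add: eF)
    then have "deriv (deriv f) z = exp (F z) * deriv F z" by (rule DERIV_imp_deriv)
    then show ?thesis using f''[OF z] eF[OF z] by (simp add: g_image)
  qed
  obtain v where v: "v holomorphic_on ball 0 1" "\<And>z. norm z < 1 \<Longrightarrow> norm (v z) \<le> norm z"
    "\<And>z. z \<in> ball 0 1 \<Longrightarrow> F z = G (v z)"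
    using subordinate_integral[OF L dG holF _ sub] G0 by (auto simp: F_def)
  define K where "K z = exp (G z / 2)" for z
  have holK: "K holomorphic_on ball 0 1" unfolding K_def by (intro holomorphic_intros holG) auto
  have dK: "deriv K 0 \<noteq> 0"
  proof -
    have "(K has_field_derivative exp (G 0 / 2) * (exp (L 0) / 2)) (at 0)"
      unfolding K_def by (intro DERIV_fun_exp DERIV_cdivide dG) auto
    from DERIV_imp_deriv[OF this] show ?thesis by (metis divide_eq_0_iff exp_not_eq_zero mult_eq_0_iff zero_neq_numeral)
  qed
  have len_k: "arclen (k_fun \<phi>) r = r * circle_energy K r"
    unfolding K_def using DERIV_imp_deriv[OF dk] r by (intro arclen_eq_circle_energy) auto
  have len_f: "arclen f r = r * circle_energy (\<lambda>z. K (v z)) r"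
    unfolding K_def using eF v(3) r by (intro arclen_eq_circle_energy) auto
  have "arclen f r = arclen (k_fun \<phi>) r"
    if \<epsilon>: "norm \<epsilon> = 1" "\<forall>z\<in>ball 0 1. f z = cnj \<epsilon> * k_fun \<phi> (\<epsilon> * z)" for \<epsilon>
  proof -
    have "deriv f z = exp (G (\<epsilon> * z))" if z: "z \<in> ball 0 1" for z
    proof -
      have "((\<lambda>z. cnj \<epsilon> * k_fun \<phi> (\<epsilon> * z)) has_field_derivative cnj \<epsilon> * (exp (G (\<epsilon> * z)) * (\<epsilon> * 1))) (at z)"
        using z \<epsilon> by (intro DERIV_cmult DERIV_chain2[OF dk] DERIV_ident) (auto simp: norm_mult)
      then have "(f has_field_derivative cnj \<epsilon> * (exp (G (\<epsilon> * z)) * (\<epsilon> * 1))) (at z)"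
        by (rule has_field_derivative_transform_within_open[OF _ open_ball z]) (use \<epsilon>(2) in auto)
      moreover have "cnj \<epsilon> * \<epsilon> = 1" using \<epsilon> by (metis complex_norm_square mult.commute of_real_1 one_power2)
      ultimately show ?thesis by (auto dest!: DERIV_imp_deriv)
    qed
    then have "arclen f r = r * circle_energy (\<lambda>z. K (\<epsilon> * z)) r"
      unfolding K_def using r by (intro arclen_eq_circle_energy) auto
    then show ?thesis using circle_energy_rotate[OF holK r \<epsilon>(1)] len_k by simp
  qed
  moreover have "\<exists>\<epsilon>. norm \<epsilon> = 1 \<and> (\<forall>z\<in>ball 0 1. f z = cnj \<epsilon> * k_fun \<phi> (\<epsilon> * z))"
    if "arclen f r = arclen (k_fun \<phi>) r"
  proof -
    have "circle_energy (\<lambda>z. K (v z)) r = circle_energy K r" using that len_f len_k r by simp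
    then obtain \<epsilon> where \<epsilon>: "norm \<epsilon> = 1" "\<And>z. norm z < 1 \<Longrightarrow> v z = \<epsilon> * z"
      using Littlewood_equality[OF v(1) holK r v(2) dK] by metis
    have \<epsilon>': "cnj \<epsilon> * \<epsilon> = 1" using \<epsilon>(1) by (metis complex_norm_square mult.commute of_real_1 one_power2)
    \<comment> \<open>As \<open>v z = \<epsilon> * z\<close>, both terms have derivative
      \<open>exp (G (\<epsilon> * z))\<close>; their difference is constant and vanishes at the
      origin.\<close>
    define D where "D z = f z - cnj \<epsilon> * k_fun \<phi> (\<epsilon> * z)" for z
    have "(D has_field_derivative 0) (at z within ball 0 1)" if z: "z \<in> ball 0 1" for z
    proof -
      have "(D has_field_derivative deriv f z - cnj \<epsilon> * (exp (G (\<epsilon> * z)) * (\<epsilon> * 1))) (at z)"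
        unfolding D_def using z \<epsilon>
        by (intro DERIV_diff holomorphic_derivI[OF holf open_ball] DERIV_cmult DERIV_chain2[OF dk] DERIV_ident)
           (auto simp: norm_mult)
      moreover have "deriv f z = exp (G (\<epsilon> * z))" using eF[OF z] v(3)[OF z] \<epsilon>(2) z by simp
      moreover have "cnj \<epsilon> * (exp (G (\<epsilon> * z)) * (\<epsilon> * 1)) = exp (G (\<epsilon> * z))" using \<epsilon>' by (simp add: mult_ac)
      ultimately have "(D has_field_derivative 0) (at z)" by (metis diff_self)
      then show ?thesis by (rule has_field_derivative_at_within)
    qed
    then obtain c where c: "\<And>z. z \<in> ball 0 1 \<Longrightarrow> D z = c"
      using has_field_derivative_zero_constant[OF convex_ball] by metis
    have "c = 0" using c[of 0] f0 k0 by (simp add: D_def)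
    then show ?thesis using c \<epsilon>(1) by (auto simp: D_def)
  qed
  ultimately show "arclen f r \<le> arclen (k_fun \<phi>) r \<and>
           (arclen f r = arclen (k_fun \<phi>) r \<longleftrightarrow>
              (\<exists>\<epsilon>. norm \<epsilon> = 1 \<and> (\<forall>z\<in>ball 0 1. f z = cnj \<epsilon> * k_fun \<phi> (\<epsilon> * z))))"
    using Littlewood_inequality[OF v(1) holK r v(2)] r len_f len_k by auto
qed

end
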